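(* Let $r\ge 2$ be an integer, let $\mathcal{X}$ be a Euclidean space and let $C_1,\ldots,C_r\subseteq\mathcal{X}$ be nonempty and closed sets. Define the subsets of $\mathcal{X}^{r-1}$ $$\boldsymbol{B}:=C_1\times\cdots\times C_{r-1},\qquad \boldsymbol{K}:=\{(x,\ldots,x)\in\mathcal{X}^{r-1}: x\in C_r\},$$ and, for $x\in\mathcal{X}$, write $\boldsymbol{j}_{r-1}(x):=(x,\ldots,x)\in\mathcal{X}^{r-1}$. Then the following statements hold. (i) If $C_i$ is super-regular at $\bar x_i\in C_i$ for all $i=1,\ldots,r-1$, then $\boldsymbol{B}$ is super-regular at $\boldsymbol{\bar x}:=(\bar x_1,\ldots,\bar x_{r-1})\in\boldsymbol{B}$. (ii) If $C_r$ is super-regular at $\bar x\in C_r$, then $\boldsymbol{K}$ is super-regular at $\boldsymbol{\bar x}:=\boldsymbol{j}_{r-1}(\bar x)\in\boldsymbol{K}$. (iii) If $\{C_1,\ldots,C_r\}$ is linearly regular around $\bar x\in\mathcal{X}$, then $\{\boldsymbol{B},\boldsymbol{K}\}$ is linearly regular around $\boldsymbol{\bar x}:=\boldsymbol{j}_{r-1}(\bar x)\in\mathcal{X}^{r-1}$. (iv) If $\{C_1,\ldots,C_r\}$ is strongly regular at $\bar x\in\mathcal{X}$, then $\{\boldsymbol{B},\boldsymbol{K}\}$ is strongly regular at $\boldsymbol{\bar x}:=\boldsymbol{j}_{r-1}(\bar x)\in\mathcal{X}^{r-1}$.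
   Context: A Euclidean space is a finite-dimensional real inner product space, with inner product $\langle\cdot,\cdot\rangle$ and induced norm $\|\cdot\|$. $\mathbb{B}(x;\delta)$ is the closed ball centered at $x$ with radius $\delta$. The product space $\mathcal{X}^{r-1}$ carries the inner product $\langle\boldsymbol{x},\boldsymbol{y}\rangle:=\sum_{i=1}^{r-1}\langle x_i,y_i\rangle$ and the induced norm, and is itself a Euclidean space. The definitions below apply in any Euclidean space $\mathcal{H}$ (in particular in $\mathcal{X}$ and $\mathcal{X}^{r-1}$). Distance: $d_C(x):=\inf_{c\in C}\|c-x\|$, with the convention $\inf\emptyset=+\infty$. Projector (set-valued): $P_C(x):=\{p\in C:\|x-p\|=\inf_{c\in C}\|c-x\|\}$. Limiting normal cone: for $x\in C$, $$N_C(x):=\Big\{\lim_{k\to\infty}\tau_k(x_k-z_k):\ \tau_k\ge 0,\ x_k\to x,\ z_k\in P_C(x_k)\text{ for all }k\in\mathbb{N}\Big\},$$ and $N_C(x):=\emptyset$ for $x\notin C$. Super-regularity: $C\subseteq\mathcal{H}$ is super-regular at $\bar x\in C$ if for every $\varepsilon>0$ there is $\delta>0$ such that $\langle u,y-z\rangle\le\varepsilon\|u\|\|y-z\|$ for all $y,z\in C\cap\mathbb{B}(\bar x;\delta)$ and all $u\in N_C(z)$. Linear regularity: a finite family $A_1,\ldots,A_m\subseteq\mathcal{H}$ is linearly regular around $\bar x\in\mathcal{H}$ if there exist $\kappa\ge 0$ and $\delta>0$ such that $d_{\cap_{i=1}^m A_i}(z)\le\kappa\max\{d_{A_i}(z):i=1,\ldots,m\}$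 for all $z\in\mathbb{B}(\bar x;\delta)$. Strong regularity: a finite family $A_1,\ldots,A_m\subseteq\mathcal{H}$ is strongly regular at $\bar x\in\mathcal{H}$ if $$\Big(\sum_{i=1}^m u_i=0\ \text{ with } u_i\in N_{A_i}(\bar x),\ i=1,\ldots,m\Big)\iff u_1=\cdots=u_m=0.$$ *)

theory Defs
  imports "HOL-Analysis.Analysis" "HOL-Library.Extended_Real"
begin

text \<open>The notions are defined in any real inner product space; finite dimensionality is a
  hypothesis of the theorem. The class \<^class>\<open>euclidean_space\<close> is not used because it excludes
  the zero space.\<close>

text \<open>The extended reals provide the convention that the infimum over the empty set is
  infinite; the library's \<^const>\<open>infdist\<close> is 0 for the empty set.\<close>

definition distance :: "'h::real_inner set \<Rightarrow> 'h \<Rightarrow> ereal" where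
  "distance C x = (INF c\<in>C. ereal (norm (c - x)))"

definition projector :: "'h::real_inner set \<Rightarrow> 'h \<Rightarrow> 'h set" where
  "projector C x = {p \<in> C. ereal (norm (x - p)) = (INF c\<in>C. ereal (norm (c - x)))}"

definition limiting_normal_cone :: "'h::real_inner set \<Rightarrow> 'h \<Rightarrow> 'h set" where
  "limiting_normal_cone C x =
    (if x \<in> C
     then {u. \<exists>(\<tau> :: nat \<Rightarrow> real) (xs :: nat \<Rightarrow> 'h) (zs :: nat \<Rightarrow> 'h).
             (\<forall>k. 0 \<le> \<tau> k) \<and> xs \<longlonglongrightarrow> x \<and> (\<forall>k. zs k \<in> projector C (xs k)) \<and>
             (\<lambda>k. \<tau> k *\<^sub>R (xs k - zs k)) \<longlonglongrightarrow> u}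
     else {})"

definition super_regular_at :: "'h::real_inner set \<Rightarrow> 'h \<Rightarrow> bool" where
  "super_regular_at C x \<longleftrightarrow>
    x \<in> C \<and>
    (\<forall>\<epsilon>>0. \<exists>\<delta>>0. \<forall>y \<in> C \<inter> cball x \<delta>. \<forall>z \<in> C \<inter> cball x \<delta>. \<forall>u \<in> limiting_normal_cone C z.
       inner u (y - z) \<le> \<epsilon> * norm u * norm (y - z))"

text \<open>A finite family \<open>A\<^sub>1, \<dots>, A\<^sub>m\<close> is given by its length \<open>m \<ge> 1\<close> and a function \<open>A\<close> on the
  naturals, of which only the values at \<open>1, \<dots>, m\<close> matter.\<close>

definition linearly_regular_around :: "nat \<Rightarrow> (nat \<Rightarrow> 'h::real_inner set) \<Rightarrow> 'h \<Rightarrow> bool" where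
  "linearly_regular_around m A x \<longleftrightarrow>
    (\<exists>\<kappa>\<ge>0. \<exists>\<delta>>0. \<forall>z \<in> cball x \<delta>.
       distance (\<Inter>i\<in>{1..m}. A i) z \<le> ereal \<kappa> * Max ((\<lambda>i. distance (A i) z) ` {1..m}))"

text \<open>The right-to-left implication requires the zero vector to lie in every normal cone, so
  strong regularity at \<open>x\<close> forces \<open>x\<close> to lie in every \<open>A\<^sub>i\<close>.\<close>

definition strongly_regular_at :: "nat \<Rightarrow> (nat \<Rightarrow> 'h::real_inner set) \<Rightarrow> 'h \<Rightarrow> bool" where
  "strongly_regular_at m A x \<longleftrightarrow>
    (\<forall>u :: nat \<Rightarrow> 'h.
       ((\<Sum>i=1..m. u i) = 0 \<and> (\<forall>i\<in>{1..m}. u i \<in> limiting_normal_cone (A i) x))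
       \<longleftrightarrow> (\<forall>i\<in>{1..m}. u i = 0))"

definition pair_family :: "'h set \<Rightarrow> 'h set \<Rightarrow> nat \<Rightarrow> 'h set" where
  "pair_family B K i = (if i = 1 then B else K)"

text \<open>The power \<open>X\<^bsup>r-1\<^esup>\<close> is the type \<^typ>\<open>'a ^ 'n\<close>, whose library inner product is the sum of
  the componentwise ones. An enumeration \<open>e\<close>, a bijection from \<open>'n\<close> onto \<open>{1..r-1}\<close>, says which
  of the numbers \<open>1, \<dots>, r-1\<close> a component carries.\<close>

definition tuple :: "('n::finite \<Rightarrow> nat) \<Rightarrow> (nat \<Rightarrow> 'a) \<Rightarrow> 'a ^ 'n" where
  "tuple e x = (\<chi> k. x (e k))"

definition product_set :: "('n::finite \<Rightarrow> nat) \<Rightarrow> (nat \<Rightarrow> 'a set) \<Rightarrow> ('a ^ 'n) set" where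
  "product_set e C = {x. \<forall>k. x $ k \<in> C (e k)}"

definition diag :: "'a \<Rightarrow> 'a ^ 'n::finite" where
  "diag x = (\<chi> k. x)"

definition diag_set :: "'a set \<Rightarrow> ('a ^ 'n::finite) set" where
  "diag_set D = {diag x | x. x \<in> D}"

end

theory Submission
  imports Defs
begin

text \<open>Everything rests on two facts about projectors. A nearest point of the product \<open>B\<close> is
  nearest in each component, because one component can be exchanged at a time. A nearest point
  \<open>diag p\<close> of \<open>K\<close> to \<open>x\<close> has \<open>p\<close> nearest, in \<open>C\<^sub>r\<close>, to the mean of the components of \<open>x\<close>,
  because the squared distance from \<open>diag c\<close> to \<open>x\<close> and the squared distance from \<open>c\<close> to that
  mean, scaled by the number of components, differ by a term not depending on \<open>c\<close>. Passing to
  limits, the components of a normal to \<open>B\<close> are normal to the respective \<open>C\<^sub>i\<close>, and the sum of the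
  components of a normal to \<open>K\<close> is normal to \<open>C\<^sub>r\<close>.

  Super-regularity of \<open>B\<close> and of \<open>K\<close> then follows by expanding the inner product into
  components and applying the Cauchy--Schwarz inequality, without loss in \<open>\<epsilon>\<close>. For strong
  regularity, if normals \<open>u\<close> to \<open>B\<close> and \<open>v\<close> to \<open>K\<close> sum to zero, then the components of \<open>u\<close>
  together with the sum of the components of \<open>v\<close> are normals to \<open>C\<^sub>1, \<dots>, C\<^sub>r\<close> summing to zero;
  hence \<open>u = 0\<close>, and \<open>v = - u = 0\<close>.

  For linear regularity, a point \<open>z\<close> of the power is compared with one of its components \<open>a\<close>.
  The triangle inequality bounds the distances from \<open>a\<close> to the \<open>C\<^sub>i\<close>, and that from \<open>z\<close> to
  \<open>diag a\<close>, by multiples of the distances from \<open>z\<close> to \<open>B\<close> and \<open>K\<close>, while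
  \<open>B \<inter> K\<close> is the diagonal copy of \<open>C\<^sub>1 \<inter> \<dots> \<inter> C\<^sub>r\<close>.\<close>

section \<open>Distances and projectors\<close>

lemma distance_eq_infdist:
  assumes "C \<noteq> {}"
  shows "distance C x = ereal (infdist x C)"
proof -
  have "bdd_below ((\<lambda>c. dist x c) ` C)"
    by (auto intro: bdd_belowI[of _ 0])
  then have "ereal (INF c\<in>C. dist x c) = (INF c\<in>C. ereal (dist x c))"
    using assms by (subst ereal_Inf') (simp_all add: image_image)
  then show ?thesis
    using assms by (simp add: distance_def infdist_def dist_norm norm_minus_commute)
qed

lemma projector_iff:
  "p \<in> projector C x \<longleftrightarrow> p \<in> C \<and> (\<forall>c\<in>C. norm (x - p) \<le> norm (x - c))"
proof (intro iffI conjI ballI)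
  assume p: "p \<in> projector C x"
  then show "p \<in> C" by (simp add: projector_def)
  fix c assume "c \<in> C"
  then have "(INF c\<in>C. ereal (norm (c - x))) \<le> ereal (norm (c - x))"
    by (rule INF_lower)
  then have "ereal (norm (x - p)) \<le> ereal (norm (c - x))"
    using p by (simp add: projector_def)
  then show "norm (x - p) \<le> norm (x - c)"
    by (simp add: norm_minus_commute)
next
  assume p: "p \<in> C \<and> (\<forall>c\<in>C. norm (x - p) \<le> norm (x - c))"
  have "ereal (norm (x - p)) = (INF c\<in>C. ereal (norm (c - x)))"
  proof (rule antisym)
    show "ereal (norm (x - p)) \<le> (INF c\<in>C. ereal (norm (c - x)))"
      using p by (intro INF_greatest) (simp add: norm_minus_commute)
    show "(INF c\<in>C. ereal (norm (c - x))) \<le> ereal (norm (x - p))"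
      using p by (intro INF_lower2[of p]) (auto simp: norm_minus_commute)
  qed
  with p show "p \<in> projector C x" by (simp add: projector_def)
qed

section \<open>Limiting normal cones\<close>

lemma limiting_normal_coneI:
  assumes "x \<in> C" and "\<And>k. 0 \<le> \<tau> k" and "xs \<longlonglongrightarrow> x"
    and "\<And>k. zs k \<in> projector C (xs k)" and "(\<lambda>k. \<tau> k *\<^sub>R (xs k - zs k)) \<longlonglongrightarrow> u"
  shows "u \<in> limiting_normal_cone C x"
  unfolding limiting_normal_cone_def using assms by auto

lemma zero_in_limiting_normal_cone:
  assumes "x \<in> C"
  shows "0 \<in> limiting_normal_cone C x"
proof -
  have "x \<in> projector C x"
    using assms by (simp add: projector_iff)
  with assms show ?thesis
    by (intro limiting_normal_coneI[where \<tau> = "\<lambda>_. 0" and xs = "\<lambda>_. x" and zs = "\<lambda>_. x"]) auto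
qed

lemma limiting_normal_cone_imp_mem: "u \<in> limiting_normal_cone C x \<Longrightarrow> x \<in> C"
  by (simp add: limiting_normal_cone_def split: if_splits)

lemma limiting_normal_cone_scaleR:
  assumes "u \<in> limiting_normal_cone C x" and "0 \<le> c"
  shows "c *\<^sub>R u \<in> limiting_normal_cone C x"
proof -
  have x: "x \<in> C" using assms(1) by (rule limiting_normal_cone_imp_mem)
  obtain \<tau> xs zs where h: "\<forall>k. 0 \<le> \<tau> k" "xs \<longlonglongrightarrow> x" "\<forall>k. zs k \<in> projector C (xs k)"
    "(\<lambda>k. \<tau> k *\<^sub>R (xs k - zs k)) \<longlonglongrightarrow> u"
    using assms(1) x by (auto simp: limiting_normal_cone_def)
  have "(\<lambda>k. (c * \<tau> k) *\<^sub>R (xs k - zs k)) \<longlonglongrightarrow> c *\<^sub>R u"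
    using tendsto_scaleR[OF tendsto_const h(4), of c] by simp
  with x h assms(2) show ?thesis
    by (intro limiting_normal_coneI[where \<tau> = "\<lambda>k. c * \<tau> k" and xs = xs and zs = zs]) auto
qed

text \<open>A bounded linear map that carries nearest points of \<open>C\<close> to nearest points of \<open>D\<close> carries
  normals to normals. It is applied below to the coordinate maps and to the mean.\<close>

lemma limiting_normal_cone_image:
  assumes L: "bounded_linear L"
    and proj: "\<And>x p. p \<in> projector C x \<Longrightarrow> L p \<in> projector D (L x)"
    and u: "u \<in> limiting_normal_cone C x"
  shows "L u \<in> limiting_normal_cone D (L x)"
proof -
  have x: "x \<in> C" using u by (rule limiting_normal_cone_imp_mem)
  obtain \<tau> xs zs where h: "\<forall>k. 0 \<le> \<tau> k" "xs \<longlonglongrightarrow> x" "\<forall>k. zs k \<in> projector C (xs k)"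
    "(\<lambda>k. \<tau> k *\<^sub>R (xs k - zs k)) \<longlonglongrightarrow> u"
    using u x by (auto simp: limiting_normal_cone_def)
  interpret L: bounded_linear L by (rule L)
  have "x \<in> projector C x"
    using x by (simp add: projector_iff)
  then have "L x \<in> D"
    using proj[of x x] by (simp add: projector_iff)
  moreover have "(\<lambda>k. L (xs k)) \<longlonglongrightarrow> L x"
    by (rule L.tendsto[OF h(2)])
  moreover have "(\<lambda>k. \<tau> k *\<^sub>R (L (xs k) - L (zs k))) \<longlonglongrightarrow> L u"
    using L.tendsto[OF h(4)] by (simp add: L.scaleR L.diff)
  ultimately show ?thesis
    using h(1,3) proj
    by (intro limiting_normal_coneI[where \<tau> = \<tau> and xs = "\<lambda>k. L (xs k)" and zs = "\<lambda>k. L (zs k)"]) auto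
qed

section \<open>Normals to the product\<close>

lemma projector_product_set_component:
  fixes x p :: "'a::real_inner ^ 'n::finite"
  assumes p: "p \<in> projector (product_set e C) x"
  shows "p $ k \<in> projector (C (e k)) (x $ k)"
  unfolding projector_iff
proof (intro conjI ballI)
  have pB: "p $ i \<in> C (e i)" for i
    using p by (simp add: projector_iff product_set_def)
  show "p $ k \<in> C (e k)" by (rule pB)
  fix c assume c: "c \<in> C (e k)"
  define q :: "'a ^ 'n" where "q = (\<chi> i. if i = k then c else p $ i)"
  have "q \<in> product_set e C"
    using c pB by (simp add: product_set_def q_def)
  then have "norm (x - p) \<le> norm (x - q)"
    using p by (simp add: projector_iff)
  then have "(\<Sum>i\<in>UNIV. (norm (x $ i - p $ i))\<^sup>2) \<le> (\<Sum>i\<in>UNIV. (norm (x $ i - q $ i))\<^sup>2)"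
    by (simp add: norm_vec_def L2_set_def)
  moreover have "(\<Sum>i\<in>UNIV. f i) = f k + (\<Sum>i\<in>UNIV - {k}. f i)" for f :: "'n \<Rightarrow> real"
    by (simp add: sum.remove)
  moreover have "(\<Sum>i\<in>UNIV - {k}. (norm (x $ i - q $ i))\<^sup>2)
      = (\<Sum>i\<in>UNIV - {k}. (norm (x $ i - p $ i))\<^sup>2)"
    by (intro sum.cong) (auto simp: q_def)
  ultimately have "(norm (x $ k - p $ k))\<^sup>2 \<le> (norm (x $ k - q $ k))\<^sup>2"
    by simp
  then show "norm (x $ k - p $ k) \<le> norm (x $ k - c)"
    by (simp add: q_def power2_le_iff_abs_le)
qed

lemma limiting_normal_cone_product_set_component:
  fixes u x :: "'a::real_inner ^ 'n::finite"
  assumes "u \<in> limiting_normal_cone (product_set e C) x"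
  shows "u $ k \<in> limiting_normal_cone (C (e k)) (x $ k)"
  using bounded_linear_vec_nth projector_product_set_component assms
  by (rule limiting_normal_cone_image)

section \<open>Normals to the diagonal\<close>

text \<open>The mean of the components; it is a left inverse of the diagonal embedding.\<close>

definition mean :: "'a::real_inner ^ 'n::finite \<Rightarrow> 'a" where
  "mean x = (1 / real CARD('n)) *\<^sub>R (\<Sum>k\<in>UNIV. x $ k)"

lemma mean_diag [simp]: "mean (diag x :: 'a::real_inner ^ 'n::finite) = x"
  by (simp add: mean_def diag_def sum_constant_scaleR)

lemma bounded_linear_mean: "bounded_linear (mean :: 'a::real_inner ^ 'n::finite \<Rightarrow> 'a)"
  unfolding mean_def[abs_def]
  by (intro bounded_linear_const_scaleR bounded_linear_sum bounded_linear_vec_nth)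

lemma CARD_scaleR_mean:
  "real CARD('n) *\<^sub>R mean x = (\<Sum>k\<in>UNIV. x $ k)" for x :: "'a::real_inner ^ 'n::finite"
  by (simp add: mean_def)

lemma inner_diag_right: "inner x (diag c) = inner (\<Sum>k\<in>UNIV. x $ k) c"
  by (simp add: inner_vec_def diag_def inner_sum_left)

lemma diag_diff: "diag x - diag y = diag (x - y)"
  by (simp add: diag_def vec_eq_iff)

lemma norm_diff_diag_power2:
  fixes x :: "'a::real_inner ^ 'n::finite"
  shows "(norm (x - diag c))\<^sup>2
    = real CARD('n) * (norm (mean x - c))\<^sup>2 + ((norm x)\<^sup>2 - real CARD('n) * (norm (mean x))\<^sup>2)"
proof -
  have "(norm (x - diag c))\<^sup>2 = (norm x)\<^sup>2 - 2 * inner x (diag c) + (norm (diag c :: 'a ^ 'n))\<^sup>2"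
    by (simp add: power2_norm_eq_inner inner_diff_left inner_diff_right inner_commute)
  also have "inner x (diag c) = real CARD('n) * inner (mean x) c"
    by (simp add: inner_diag_right flip: CARD_scaleR_mean)
  also have "(norm (diag c :: 'a ^ 'n))\<^sup>2 = real CARD('n) * (norm c)\<^sup>2"
    by (simp add: power2_norm_eq_inner inner_vec_def diag_def)
  finally show ?thesis
    by (simp add: power2_norm_eq_inner inner_diff_left inner_diff_right inner_commute algebra_simps)
qed

lemma projector_diag_set_mean:
  fixes x p :: "'a::real_inner ^ 'n::finite"
  assumes "p \<in> projector (diag_set D) x"
  shows "mean p \<in> projector D (mean x)"
proof -
  obtain q where q: "p = diag q" "q \<in> D"
    using assms by (auto simp: projector_iff diag_set_def)
  have "norm (mean x - q) \<le> norm (mean x - c)" if "c \<in> D" for c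
  proof -
    have "norm (x - diag q) \<le> norm (x - diag c)"
      using assms that q by (auto simp: projector_iff diag_set_def)
    then have "(norm (x - diag q))\<^sup>2 \<le> (norm (x - diag c))\<^sup>2"
      by (rule power_mono) simp
    then have "(norm (mean x - q))\<^sup>2 \<le> (norm (mean x - c))\<^sup>2"
      by (simp add: norm_diff_diag_power2)
    then show ?thesis by (simp add: power2_le_iff_abs_le)
  qed
  with q show ?thesis by (simp add: projector_iff)
qed

text \<open>Nearest points give the mean of the components; the sum is a nonnegative multiple of it,
  and the normal cone is closed under such multiples.\<close>

lemma limiting_normal_cone_diag_set_sum:
  fixes u :: "'a::real_inner ^ 'n::finite"
  assumes "u \<in> limiting_normal_cone (diag_set D) (diag x)"
  shows "(\<Sum>k\<in>UNIV. u $ k) \<in> limiting_normal_cone D x"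
proof -
  have "mean u \<in> limiting_normal_cone D (mean (diag x :: 'a ^ 'n))"
    using bounded_linear_mean projector_diag_set_mean assms by (rule limiting_normal_cone_image)
  then have "real CARD('n) *\<^sub>R mean u \<in> limiting_normal_cone D x"
    by (intro limiting_normal_cone_scaleR) simp_all
  then show ?thesis by (simp only: CARD_scaleR_mean)
qed

section \<open>Super-regularity\<close>

lemma sum_norm_mult_le_norm_mult:
  fixes u v :: "'a::real_inner ^ 'n::finite"
  shows "(\<Sum>k\<in>UNIV. norm (u $ k) * norm (v $ k)) \<le> norm u * norm v"
  using L2_set_mult_ineq[of "\<lambda>k. norm (u $ k)" "\<lambda>k. norm (v $ k)" UNIV]
  by (simp add: norm_vec_def)

lemma super_regular_at_product_set:
  fixes e :: "'n::finite \<Rightarrow> nat" and C :: "nat \<Rightarrow> 'a::real_inner set"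
  assumes "\<And>k. super_regular_at (C (e k)) (xbar (e k))"
  shows "super_regular_at (product_set e C) (tuple e xbar)"
  unfolding super_regular_at_def
proof (intro conjI allI impI)
  show "tuple e xbar \<in> product_set e C"
    using assms by (simp add: tuple_def product_set_def super_regular_at_def)
  fix \<epsilon> :: real assume "\<epsilon> > 0"
  then have "\<forall>k. \<exists>\<delta>>0. \<forall>y \<in> C (e k) \<inter> cball (xbar (e k)) \<delta>.
      \<forall>z \<in> C (e k) \<inter> cball (xbar (e k)) \<delta>. \<forall>u \<in> limiting_normal_cone (C (e k)) z.
        inner u (y - z) \<le> \<epsilon> * norm u * norm (y - z)"
    using assms unfolding super_regular_at_def by blast
  then obtain d where d: "\<And>k. d k > 0"
    and reg: "\<And>k y z u. \<lbrakk>y \<in> C (e k) \<inter> cball (xbar (e k)) (d k);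
      z \<in> C (e k) \<inter> cball (xbar (e k)) (d k); u \<in> limiting_normal_cone (C (e k)) z\<rbrakk>
      \<Longrightarrow> inner u (y - z) \<le> \<epsilon> * norm u * norm (y - z)"
    by metis
  define \<delta> where "\<delta> = Min (range d)"
  have "\<delta> > 0" using d by (auto simp: \<delta>_def)
  have \<delta>: "\<delta> \<le> d k" for k by (simp add: \<delta>_def)
  have comp: "y $ k \<in> C (e k) \<inter> cball (xbar (e k)) (d k)"
    if "y \<in> product_set e C \<inter> cball (tuple e xbar) \<delta>" for y k
  proof -
    have "dist (xbar (e k)) (y $ k) \<le> dist (tuple e xbar) y"
      using dist_vec_nth_le[of "tuple e xbar" k y] by (simp add: tuple_def)
    with that \<delta>[of k] show ?thesis by (auto simp: product_set_def)
  qed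
  have "inner u (y - z) \<le> \<epsilon> * norm u * norm (y - z)"
    if y: "y \<in> product_set e C \<inter> cball (tuple e xbar) \<delta>"
      and z: "z \<in> product_set e C \<inter> cball (tuple e xbar) \<delta>"
      and u: "u \<in> limiting_normal_cone (product_set e C) z" for y z u
  proof -
    have "inner u (y - z) = (\<Sum>k\<in>UNIV. inner (u $ k) (y $ k - z $ k))"
      by (simp add: inner_vec_def)
    also have "\<dots> \<le> (\<Sum>k\<in>UNIV. \<epsilon> * norm (u $ k) * norm (y $ k - z $ k))"
      using comp[OF y] comp[OF z] limiting_normal_cone_product_set_component[OF u]
      by (intro sum_mono reg)
    also have "\<dots> = \<epsilon> * (\<Sum>k\<in>UNIV. norm (u $ k) * norm ((y - z) $ k))"
      by (simp add: sum_distrib_left mult.assoc)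
    also have "\<dots> \<le> \<epsilon> * (norm u * norm (y - z))"
      using \<open>\<epsilon> > 0\<close> by (intro mult_left_mono sum_norm_mult_le_norm_mult) simp
    finally show ?thesis by (simp add: mult.assoc)
  qed
  with \<open>\<delta> > 0\<close> show "\<exists>\<delta>>0. \<forall>y \<in> product_set e C \<inter> cball (tuple e xbar) \<delta>.
      \<forall>z \<in> product_set e C \<inter> cball (tuple e xbar) \<delta>.
      \<forall>u \<in> limiting_normal_cone (product_set e C) z.
        inner u (y - z) \<le> \<epsilon> * norm u * norm (y - z)"
    by blast
qed

lemma super_regular_at_diag_set:
  fixes D :: "'a::real_inner set"
  assumes "super_regular_at D x"
  shows "super_regular_at (diag_set D :: ('a ^ 'n::finite) set) (diag x)"
  unfolding super_regular_at_def
proof (intro conjI allI impI)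
  show "diag x \<in> (diag_set D :: ('a ^ 'n) set)"
    using assms by (auto simp: diag_set_def super_regular_at_def)
  fix \<epsilon> :: real assume "\<epsilon> > 0"
  then obtain \<delta> where "\<delta> > 0"
    and reg: "\<And>y z u. \<lbrakk>y \<in> D \<inter> cball x \<delta>; z \<in> D \<inter> cball x \<delta>; u \<in> limiting_normal_cone D z\<rbrakk>
      \<Longrightarrow> inner u (y - z) \<le> \<epsilon> * norm u * norm (y - z)"
    using assms unfolding super_regular_at_def by blast
  have ball: "y \<in> cball x \<delta>" if "(diag y :: 'a ^ 'n) \<in> cball (diag x) \<delta>" for y
    using that dist_vec_nth_le[of "diag x :: 'a ^ 'n" undefined "diag y"]
    by (simp add: diag_def)
  have "inner u (diag y - diag z) \<le> \<epsilon> * norm u * norm (diag y - diag z :: 'a ^ 'n)"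
    if y: "y \<in> D" "(diag y :: 'a ^ 'n) \<in> cball (diag x) \<delta>"
      and z: "z \<in> D" "(diag z :: 'a ^ 'n) \<in> cball (diag x) \<delta>"
      and u: "u \<in> limiting_normal_cone (diag_set D) (diag z :: 'a ^ 'n)" for y z u
  proof -
    have "inner u (diag y - diag z) = inner (\<Sum>k\<in>UNIV. u $ k) (y - z)"
      by (simp add: diag_diff inner_diag_right)
    also have "\<dots> \<le> \<epsilon> * norm (\<Sum>k\<in>UNIV. u $ k) * norm (y - z)"
      using y z ball limiting_normal_cone_diag_set_sum[OF u] by (intro reg) auto
    also have "\<dots> \<le> \<epsilon> * (\<Sum>k\<in>UNIV. norm (u $ k)) * norm (y - z)"
      using \<open>\<epsilon> > 0\<close> by (intro mult_right_mono mult_left_mono norm_sum) auto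
    also have "\<dots> = \<epsilon> * (\<Sum>k\<in>UNIV. norm (u $ k) * norm ((diag (y - z) :: 'a ^ 'n) $ k))"
      by (simp add: sum_distrib_right mult.assoc diag_def)
    also have "\<dots> \<le> \<epsilon> * (norm u * norm (diag (y - z) :: 'a ^ 'n))"
      using \<open>\<epsilon> > 0\<close> by (intro mult_left_mono sum_norm_mult_le_norm_mult) simp
    finally show ?thesis by (simp add: mult.assoc diag_diff)
  qed
  with \<open>\<delta> > 0\<close> show "\<exists>\<delta>>0. \<forall>y \<in> diag_set D \<inter> cball (diag x :: 'a ^ 'n) \<delta>.
      \<forall>z \<in> diag_set D \<inter> cball (diag x) \<delta>. \<forall>u \<in> limiting_normal_cone (diag_set D) z.
        inner u (y - z) \<le> \<epsilon> * norm u * norm (y - z)"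
    by (intro exI[of _ \<delta>]) (auto simp: diag_set_def)
qed

section \<open>Linear regularity\<close>

lemma Max_pair_family:
  "Max ((\<lambda>i. f (pair_family B K i)) ` {1..2}) = max (f B) (f K)"
proof -
  have "{1..2::nat} = {1, 2}" by auto
  then show ?thesis by (simp add: pair_family_def)
qed

lemma Inter_pair_family: "(\<Inter>i\<in>{1..2}. pair_family B K i) = B \<inter> K"
proof -
  have "{1..2::nat} = {1, 2}" by auto
  then show ?thesis by (simp add: pair_family_def Int_commute)
qed

lemma le_infdist_iff:
  assumes "C \<noteq> {}"
  shows "a \<le> infdist x C \<longleftrightarrow> (\<forall>c\<in>C. a \<le> dist x c)"
proof -
  have "bdd_below ((\<lambda>c. dist x c) ` C)"
    by (auto intro: bdd_belowI[of _ 0])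
  then show ?thesis
    using assms by (simp add: infdist_def le_cINF_iff)
qed

text \<open>With all sets nonempty, the extended-real condition is one on real distances; that the
  intersection is nonempty is part of what linear regularity asserts.\<close>

lemma linearly_regular_around_iff:
  assumes "m \<ge> 1" and "\<And>i. i \<in> {1..m} \<Longrightarrow> A i \<noteq> {}"
  shows "linearly_regular_around m A x \<longleftrightarrow>
    (\<Inter>i\<in>{1..m}. A i) \<noteq> {} \<and>
    (\<exists>\<kappa>\<ge>0. \<exists>\<delta>>0. \<forall>z \<in> cball x \<delta>.
       infdist z (\<Inter>i\<in>{1..m}. A i) \<le> \<kappa> * Max ((\<lambda>i. infdist z (A i)) ` {1..m}))"
proof -
  have Max_eq: "Max ((\<lambda>i. distance (A i) z) ` {1..m})
      = ereal (Max ((\<lambda>i. infdist z (A i)) ` {1..m}))" for z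
  proof -
    have "ereal (Max ((\<lambda>i. infdist z (A i)) ` {1..m}))
        = Max (ereal ` (\<lambda>i. infdist z (A i)) ` {1..m})"
      using assms(1) by (intro mono_Max_commute) (auto intro: monoI)
    also have "ereal ` (\<lambda>i. infdist z (A i)) ` {1..m} = (\<lambda>i. distance (A i) z) ` {1..m}"
      using assms(2) by (auto simp: image_image distance_eq_infdist intro!: image_cong)
    finally show ?thesis by simp
  qed
  show ?thesis
  proof (cases "(\<Inter>i\<in>{1..m}. A i) = {}")
    case True
    then have "distance (\<Inter>i\<in>{1..m}. A i) z = \<infinity>" for z
      by (simp add: distance_def top_ereal_def)
    then have "\<not> distance (\<Inter>i\<in>{1..m}. A i) x \<le> ereal \<kappa> * ereal M" for \<kappa> M
      by simp
    moreover have "x \<in> cball x \<delta>" if "\<delta> > 0" for \<delta>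
      using that by simp
    ultimately have "\<not> linearly_regular_around m A x"
      unfolding linearly_regular_around_def Max_eq by blast
    with True show ?thesis by blast
  next
    case False
    then show ?thesis
      unfolding linearly_regular_around_def Max_eq distance_eq_infdist[OF False] by simp
  qed
qed

lemma norm_le_CARD_mult:
  fixes v :: "'a::real_inner ^ 'n::finite"
  assumes "\<And>k. norm (v $ k) \<le> c"
  shows "norm v \<le> real CARD('n) * c"
proof -
  have "norm v \<le> (\<Sum>k\<in>UNIV. norm (v $ k))"
    by (simp add: norm_vec_def L2_set_le_sum)
  also have "\<dots> \<le> (\<Sum>k\<in>(UNIV :: 'n set). c)"
    by (intro sum_mono assms)
  finally show ?thesis by simp
qed

lemma linearly_regular_around_product_diag:
  fixes C :: "nat \<Rightarrow> 'a::real_inner set" and e :: "'n::finite \<Rightarrow> nat"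
  assumes "r \<ge> 2" and e: "bij_betw e UNIV {1..r - 1}"
    and ne: "\<And>i. i \<in> {1..r} \<Longrightarrow> C i \<noteq> {}"
    and lin: "linearly_regular_around r C x"
  shows "linearly_regular_around 2 (pair_family (product_set e C) (diag_set (C r))) (diag x)"
proof -
  define B where "B = product_set e C"
  define K :: "('a ^ 'n) set" where "K = diag_set (C r)"
  define I where "I = (\<Inter>i\<in>{1..r}. C i)"
  define n where "n = real CARD('n)"
  have "n > 0" by (simp add: n_def)
  have split_r: "{1..r} = insert r (range e)"
    using e \<open>r \<ge> 2\<close> by (auto simp: bij_betw_def)
  obtain p0 \<kappa> \<delta> where p0: "p0 \<in> I" and "\<kappa> \<ge> 0" "\<delta> > 0"
    and reg: "\<And>z. z \<in> cball x \<delta> \<Longrightarrow>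
      infdist z I \<le> \<kappa> * Max ((\<lambda>i. infdist z (C i)) ` {1..r})"
  proof -
    have "I \<noteq> {} \<and> (\<exists>\<kappa>\<ge>0. \<exists>\<delta>>0. \<forall>z \<in> cball x \<delta>.
        infdist z I \<le> \<kappa> * Max ((\<lambda>i. infdist z (C i)) ` {1..r}))"
      using lin \<open>r \<ge> 2\<close> ne unfolding I_def by (subst (asm) linearly_regular_around_iff) auto
    with that show ?thesis by blast
  qed
  have BK: "B \<inter> K = diag ` I"
  proof -
    have "p \<in> I \<longleftrightarrow> p \<in> C r \<and> (\<forall>k. p \<in> C (e k))" for p
      unfolding I_def split_r by auto
    then show ?thesis
      by (auto simp: B_def K_def product_set_def diag_set_def diag_def)
  qed
  then have BK_ne: "B \<inter> K \<noteq> {}" using p0 by auto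
  then have "B \<noteq> {}" "K \<noteq> {}" "I \<noteq> {}" using p0 by auto
  have main: "infdist z (B \<inter> K) \<le> (3 * n * \<kappa> + 2 * n) * max (infdist z B) (infdist z K)"
    if z: "z \<in> cball (diag x) \<delta>" for z
  proof -
    define M where "M = max (infdist z B) (infdist z K)"
    \<comment> \<open>any component of \<open>z\<close> would do\<close>
    define a where "a = z $ undefined"
    have "dist x a \<le> dist (diag x) z"
      using dist_vec_nth_le[of "diag x" undefined z] by (simp add: diag_def a_def)
    with z have a: "a \<in> cball x \<delta>" by simp
    \<comment> \<open>any two components of \<open>z\<close> lie close to a common point \<open>c\<close> of \<open>C r\<close>\<close>
    have az: "dist a (z $ k) \<le> 2 * infdist z K" for k
    proof -
      have "dist a (z $ k) / 2 \<le> infdist z K"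
        unfolding le_infdist_iff[OF \<open>K \<noteq> {}\<close>]
      proof
        fix w assume "w \<in> K"
        then obtain c where w: "w = diag c" by (auto simp: K_def diag_set_def)
        have "dist (z $ i) c \<le> dist z w" for i
          using dist_vec_nth_le[of z i w] by (simp add: w diag_def)
        then have "dist a c \<le> dist z w" "dist (z $ k) c \<le> dist z w"
          by (simp_all add: a_def)
        then show "dist a (z $ k) / 2 \<le> dist z w"
          using dist_triangle2[of a "z $ k" c] by simp
      qed
      then show ?thesis by simp
    qed
    have dK: "infdist a (C r) \<le> infdist z K"
      unfolding le_infdist_iff[OF \<open>K \<noteq> {}\<close>]
    proof
      fix w assume "w \<in> K"
      then obtain c where w: "w = diag c" "c \<in> C r" by (auto simp: K_def diag_set_def)
      have "infdist a (C r) \<le> dist a c" using w(2) by (rule infdist_le)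
      also have "\<dots> \<le> dist z w"
        using dist_vec_nth_le[of z undefined w] by (simp add: w diag_def a_def)
      finally show "infdist a (C r) \<le> dist z w" .
    qed
    have dB: "infdist a (C (e k)) \<le> infdist z B + 2 * infdist z K" for k
    proof -
      have "infdist a (C (e k)) - 2 * infdist z K \<le> infdist z B"
        unfolding le_infdist_iff[OF \<open>B \<noteq> {}\<close>]
      proof
        fix w assume w: "w \<in> B"
        then have "infdist a (C (e k)) \<le> dist a (w $ k)"
          by (intro infdist_le) (simp add: B_def product_set_def)
        also have "\<dots> \<le> dist a (z $ k) + dist (z $ k) (w $ k)" by (rule dist_triangle)
        also have "\<dots> \<le> 2 * infdist z K + dist z w"
          using az dist_vec_nth_le by (intro add_mono)
        finally show "infdist a (C (e k)) - 2 * infdist z K \<le> dist z w" by simp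
      qed
      then show ?thesis by simp
    qed
    have M: "infdist z B \<le> M" "infdist z K \<le> M" "0 \<le> M"
      using infdist_nonneg[of z B] by (auto simp: M_def)
    have "infdist a (C i) \<le> 3 * M" if i: "i \<in> {1..r}" for i
    proof (cases "i = r")
      case True
      then show ?thesis using dK M by simp
    next
      case False
      then obtain k where "i = e k" using i unfolding split_r by auto
      then show ?thesis using dB[of k] M by simp
    qed
    then have "Max ((\<lambda>i. infdist a (C i)) ` {1..r}) \<le> 3 * M"
      using \<open>r \<ge> 2\<close> by simp
    then have I: "infdist a I \<le> \<kappa> * (3 * M)"
      using reg[OF a] \<open>\<kappa> \<ge> 0\<close> by (meson mult_left_mono order_trans)
    have bound: "infdist z (B \<inter> K) \<le> n * dist a p + n * (2 * infdist z K)" if p: "p \<in> I" for p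
    proof -
      have "infdist z (B \<inter> K) \<le> dist z (diag p)"
        using p by (intro infdist_le) (simp add: BK)
      also have "\<dots> \<le> n * (dist a p + 2 * infdist z K)"
        unfolding dist_norm[of z] n_def
      proof (rule norm_le_CARD_mult)
        fix k
        show "norm ((z - diag p) $ k) \<le> dist a p + 2 * infdist z K"
          using dist_triangle3[of "z $ k" p a] az[of k] by (simp add: diag_def flip: dist_norm)
      qed
      finally show ?thesis by (simp add: distrib_left)
    qed
    \<comment> \<open>infimum of \<open>bound\<close> over \<open>p\<close>, rearranged so that \<open>dist a p\<close> stands alone\<close>
    have "(infdist z (B \<inter> K) - n * (2 * infdist z K)) / n \<le> infdist a I"
      unfolding le_infdist_iff[OF \<open>I \<noteq> {}\<close>]
      using bound \<open>n > 0\<close> by (fastforce simp: divide_le_eq mult.commute)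
    then have "infdist z (B \<inter> K) \<le> n * infdist a I + n * (2 * infdist z K)"
      using \<open>n > 0\<close> by (simp add: divide_le_eq mult.commute)
    also have "\<dots> \<le> n * (\<kappa> * (3 * M)) + n * (2 * M)"
      using I \<open>n > 0\<close> by (intro add_mono mult_left_mono) (auto simp: M_def)
    finally show ?thesis by (simp add: M_def[symmetric] algebra_simps)
  qed
  have "pair_family B K i \<noteq> {}" for i
    using \<open>B \<noteq> {}\<close> \<open>K \<noteq> {}\<close> by (simp add: pair_family_def)
  then have "linearly_regular_around 2 (pair_family B K) (diag x) \<longleftrightarrow>
      B \<inter> K \<noteq> {} \<and> (\<exists>\<kappa>\<ge>0. \<exists>\<delta>>0. \<forall>z \<in> cball (diag x) \<delta>.
        infdist z (B \<inter> K) \<le> \<kappa> * max (infdist z B) (infdist z K))"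
    by (subst linearly_regular_around_iff)
      (simp_all only: Inter_pair_family Max_pair_family[where f = "infdist _"], simp_all)
  moreover have "3 * n * \<kappa> + 2 * n \<ge> 0"
    using \<open>n > 0\<close> \<open>\<kappa> \<ge> 0\<close> by simp
  ultimately show ?thesis
    using BK_ne main \<open>\<delta> > 0\<close> unfolding B_def K_def by blast
qed

section \<open>Strong regularity\<close>

lemma strongly_regular_at_imp_mem:
  assumes "strongly_regular_at m A x" and "i \<in> {1..m}"
  shows "x \<in> A i"
proof -
  have "0 \<in> limiting_normal_cone (A i) x"
    using assms(1)[unfolded strongly_regular_at_def, rule_format, of "\<lambda>_. 0"] assms(2) by simp
  then show ?thesis by (rule limiting_normal_cone_imp_mem)
qed

lemma strongly_regular_at_product_diag:
  fixes C :: "nat \<Rightarrow> 'a::real_inner set" and e :: "'n::finite \<Rightarrow> nat"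
  assumes "r \<ge> 2" and e: "bij_betw e UNIV {1..r - 1}"
    and str: "strongly_regular_at r C x"
  shows "strongly_regular_at 2 (pair_family (product_set e C) (diag_set (C r))) (diag x)"
proof -
  define B where "B = product_set e C"
  define K :: "('a ^ 'n) set" where "K = diag_set (C r)"
  have two: "{1..2::nat} = {1, 2}" by auto
  have er: "e k \<in> {1..r - 1}" for k
    using e by (auto simp: bij_betw_def)
  have x: "x \<in> C i" if "i \<in> {1..r}" for i
    using str that by (rule strongly_regular_at_imp_mem)
  have "e k \<in> {1..r}" for k using er[of k] by auto
  then have "diag x \<in> B" "diag x \<in> K"
    using x \<open>r \<ge> 2\<close> by (auto simp: B_def K_def product_set_def diag_set_def diag_def)
  then have zero: "0 \<in> limiting_normal_cone B (diag x)" "0 \<in> limiting_normal_cone K (diag x)"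
    by (simp_all add: zero_in_limiting_normal_cone)
  have uv: "u = 0 \<and> v = 0"
    if u: "u \<in> limiting_normal_cone B (diag x)" and v: "v \<in> limiting_normal_cone K (diag x)"
      and "u + v = 0" for u v
  proof -
    \<comment> \<open>the family of normals to \<open>C 1, \<dots>, C r\<close> assembled from \<open>u\<close> and \<open>v\<close>\<close>
    define w where "w i = (if i = r then \<Sum>k\<in>UNIV. v $ k else u $ inv e i)" for i
    have inj: "inj e" using e by (simp add: bij_betw_def)
    have w_e: "w (e k) = u $ k" for k
    proof -
      have "e k \<noteq> r" using er[of k] \<open>r \<ge> 2\<close> by auto
      then show ?thesis using inj by (simp add: w_def)
    qed
    have split_r: "{1..r} = insert r {1..r - 1}"
      using \<open>r \<ge> 2\<close> by auto
    have "(\<Sum>i=1..r - 1. w i) = (\<Sum>k\<in>UNIV. u $ k)"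
      by (simp only: sum.reindex_bij_betw[OF e, symmetric] w_e)
    moreover have "(\<Sum>i=1..r. w i) = w r + (\<Sum>i=1..r - 1. w i)"
      unfolding split_r using \<open>r \<ge> 2\<close> by (intro sum.insert) auto
    ultimately have "(\<Sum>i=1..r. w i) = (\<Sum>k\<in>UNIV. (u + v) $ k)"
      by (simp add: sum.distrib w_def add.commute)
    then have "(\<Sum>i=1..r. w i) = 0"
      using \<open>u + v = 0\<close> by simp
    moreover have "w i \<in> limiting_normal_cone (C i) x" if i: "i \<in> {1..r}" for i
    proof (cases "i = r")
      case True
      then show ?thesis
        using limiting_normal_cone_diag_set_sum v by (simp add: w_def K_def)
    next
      case False
      with i have "i \<in> range e"
        using e unfolding split_r bij_betw_def by auto
      then obtain k where "i = e k" by blast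
      then show ?thesis
        using limiting_normal_cone_product_set_component[OF u[unfolded B_def], of k]
        by (simp add: w_e diag_def)
    qed
    ultimately have w0: "\<forall>i\<in>{1..r}. w i = 0"
      using str unfolding strongly_regular_at_def by blast
    have "u $ k = 0" for k
    proof -
      have "e k \<in> {1..r}" using er[of k] by auto
      with w0 have "w (e k) = 0" by blast
      then show ?thesis by (simp add: w_e)
    qed
    then have "u = 0" by (simp add: vec_eq_iff)
    with \<open>u + v = 0\<close> show ?thesis by simp
  qed
  have "strongly_regular_at 2 (pair_family B K) (diag x)"
    unfolding strongly_regular_at_def two using uv zero by (fastforce simp: pair_family_def)
  then show ?thesis by (simp add: B_def K_def)
qed

section \<open>Regularity of the product and of the diagonal\<close>

theorem theorem3p4:
  fixes r :: nat
    and C :: "nat \<Rightarrow> 'a::real_inner set"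
    and e :: "'n::finite \<Rightarrow> nat"
    and B K :: "('a ^ 'n) set"
  assumes "\<exists>S :: 'a set. finite S \<and> span S = UNIV"
    and "r \<ge> 2"
    and "bij_betw e (UNIV :: 'n set) {1..r - 1}"
    and "\<forall>i\<in>{1..r}. C i \<noteq> {} \<and> closed (C i)"
    and "B = product_set e C"
    and "K = diag_set (C r)"
  shows "(\<forall>xbar :: nat \<Rightarrow> 'a.
            (\<forall>i\<in>{1..r - 1}. super_regular_at (C i) (xbar i))
            \<longrightarrow> super_regular_at B (tuple e xbar))
       \<and> (\<forall>xbar :: 'a. super_regular_at (C r) xbar \<longrightarrow> super_regular_at K (diag xbar))
       \<and> (\<forall>xbar :: 'a. linearly_regular_around r C xbar
            \<longrightarrow> linearly_regular_around 2 (pair_family B K) (diag xbar))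
       \<and> (\<forall>xbar :: 'a. strongly_regular_at r C xbar
            \<longrightarrow> strongly_regular_at 2 (pair_family B K) (diag xbar))"
proof -
  have e: "e k \<in> {1..r - 1}" for k
    using assms(3) by (auto simp: bij_betw_def)
  have ne: "C i \<noteq> {}" if "i \<in> {1..r}" for i
    using assms(4) that by blast
  show ?thesis
    unfolding assms(5,6)
  proof (intro conjI allI impI)
    fix xbar :: "nat \<Rightarrow> 'a"
    assume "\<forall>i\<in>{1..r - 1}. super_regular_at (C i) (xbar i)"
    with e show "super_regular_at (product_set e C) (tuple e xbar)"
      by (intro super_regular_at_product_set) blast
  qed (use assms(2,3) ne in \<open>auto intro: super_regular_at_diag_set
    linearly_regular_around_product_diag strongly_regular_at_product_diag\<close>)
qed

end
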